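(* Let $p$ be an odd prime, $r,q\ge1$ integers, $\varepsilon=p^r$. For $c,s\in R_q$, the group commutator $C_cS_sC_c^{-1}S_s^{-1}$ acts projectively by the Möbius matrix $$L_cU_sL_c^{-1}U_s^{-1}=\begin{pmatrix}1-\varepsilon cs&\varepsilon cs^2\\ -\varepsilon^2c^2s&1+\varepsilon cs+\varepsilon^2c^2s^2\end{pmatrix},$$ where $L_c$ and $U_s$ are the Möbius matrices of the column actions of $C_c$ and $S_s$, and it is projectively scalar if and only if $\varepsilon cs\equiv0\pmod{p^q}$, that is, if and only if $v_p(cs)\ge q-r$. Consequently the commutator is scalar for all $c,s\in R_q$ if and only if $q\le r$; and for $q>r$ a rectangle $p^\alpha R_q\times p^\beta R_q$ ($0\le\alpha,\beta\le q$) has scalar commutators for all $(c,s)$ in it exactly when $r+\alpha+\beta\ge q$.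
   Context: $\mathbf Z_p$ is the ring of $p$-adic integers, $R_q=\mathbf Z/p^q\mathbf Z$. $\chi$ is a fixed faithful (injective) character of the cyclic group $(1+p^r\mathbf Z_p)/(1+p^{q+r}\mathbf Z_p)$ of order $p^q$, with values in complex roots of unity. For $c,s\in R_q$ define operators on functions $f:R_q\to\mathbf C$ by $$(C_cf)(b)=\chi(1+\varepsilon cb)\,f\!\left(\frac{b}{1+\varepsilon cb}\right),\qquad (S_sf)(b)=f(b+s).$$ Their column actions are the Möbius maps $b\mapsto b/(1+\varepsilon cb)$ and $b\mapsto b+s$ of $R_q$, with matrices $$L_c=\begin{pmatrix}1&0\\ \varepsilon c&1\end{pmatrix},\qquad U_s=\begin{pmatrix}1&s\\0&1\end{pmatrix}$$ over $R_q$. The commutator is called (projectively) scalar if the operator $C_cS_sC_c^{-1}S_s^{-1}$ is a scalar multiple of the identity; equivalently, its matrix $L_cU_sL_c^{-1}U_s^{-1}$ is a scalar matrix over $R_q$, i.e. trivial in $\mathrm{PGL}_2(R_q)$. $v_p$ is the $p$-adic valuation, with $v_p(0)=\infty$ for $0\in R_q$.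
   Formalization: As composition of operators, CSC⁻¹S⁻¹ acts by U⁻¹L⁻¹UL, not LUL⁻¹U⁻¹ (differ at b=0 for p=3, r=1, q=3, c=s=1); LUL⁻¹U⁻¹ is stated as the commutator of the column maps and the action of S⁻¹C⁻¹SC. All scalarity claims concern CSC⁻¹S⁻¹ itself. *)

theory Defs
  imports
    "HOL-Analysis.Analysis"
    "HOL-Algebra.Coset"
    "HOL-Algebra.Ring"
    "Berlekamp_Zassenhaus.Finite_Field"
begin

text \<open>
  The ring \<open>R_q = Z/p^q Z\<close> is the type \<open>'n mod_ring\<close> with \<open>CARD('n) = p ^ q\<close>; its canonical
  integer representatives are given by \<^const>\<open>to_int_mod_ring\<close>.
\<close>

text \<open>
  The p-adic integers as the inverse limit of the rings \<open>Z/p^n Z\<close>: an element is a compatible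
  sequence whose \<open>n\<close>-th entry is the reduced residue modulo \<open>p^n\<close>.
\<close>

definition Zp :: "nat \<Rightarrow> (nat \<Rightarrow> int) ring" where
  "Zp p = \<lparr>carrier = {x. \<forall>n. 0 \<le> x n \<and> x n < int p ^ n \<and> x (Suc n) mod int p ^ n = x n},
           monoid.mult = (\<lambda>x y n. (x n * y n) mod int p ^ n),
           one = (\<lambda>n. 1 mod int p ^ n),
           zero = (\<lambda>n. 0),
           add = (\<lambda>x y n. (x n + y n) mod int p ^ n)\<rparr>"

definition Zp_of_int :: "nat \<Rightarrow> int \<Rightarrow> nat \<Rightarrow> int" where
  "Zp_of_int p k = (\<lambda>n. k mod int p ^ n)"

text \<open>The set \<open>1 + p^m Z_p\<close>, which for \<open>m \<ge> 1\<close> is a group of units.\<close>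

definition principal_units :: "nat \<Rightarrow> nat \<Rightarrow> (nat \<Rightarrow> int) set" where
  "principal_units p m =
     {\<one>\<^bsub>Zp p\<^esub> \<oplus>\<^bsub>Zp p\<^esub> Zp_of_int p (int p ^ m) \<otimes>\<^bsub>Zp p\<^esub> x | x. x \<in> carrier (Zp p)}"

definition principal_unit_group :: "nat \<Rightarrow> nat \<Rightarrow> (nat \<Rightarrow> int) monoid" where
  "principal_unit_group p m = (units_of (Zp p))\<lparr>carrier := principal_units p m\<rparr>"

text \<open>The quotient \<open>(1 + p^r Z_p) / (1 + p^(q+r) Z_p)\<close>; its elements are cosets.\<close>

definition unit_quotient :: "nat \<Rightarrow> nat \<Rightarrow> nat \<Rightarrow> (nat \<Rightarrow> int) set monoid" where
  "unit_quotient p r q = principal_unit_group p r Mod principal_units p (q + r)"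

definition unit_class :: "nat \<Rightarrow> nat \<Rightarrow> nat \<Rightarrow> int \<Rightarrow> (nat \<Rightarrow> int) set" where
  "unit_class p r q k =
     principal_units p (q + r) #>\<^bsub>principal_unit_group p r\<^esub> Zp_of_int p k"

definition roots_of_unity_group :: "complex monoid" where
  "roots_of_unity_group =
     \<lparr>carrier = {z. \<exists>n>0. z ^ n = 1}, monoid.mult = (*), one = 1\<rparr>"

definition faithful_character ::
    "nat \<Rightarrow> nat \<Rightarrow> nat \<Rightarrow> ((nat \<Rightarrow> int) set \<Rightarrow> complex) \<Rightarrow> bool" where
  "faithful_character p r q chi \<longleftrightarrow>
     chi \<in> hom (unit_quotient p r q) roots_of_unity_group \<and>
     inj_on chi (carrier (unit_quotient p r q))"

text \<open>The quotient \<open>x / y\<close>, meaningful when \<open>y\<close> is a unit.\<close>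

definition unit_div :: "'a::comm_ring_1 \<Rightarrow> 'a \<Rightarrow> 'a" where
  "unit_div x y = (THE z. z * y = x)"

text \<open>
  The class of \<open>1 + \<epsilon>cb\<close> modulo \<open>p^(q+r)\<close> does not depend on the representatives of \<open>c\<close> and \<open>b\<close>
  modulo \<open>p^q\<close>, since \<open>\<epsilon> = p^r\<close>.
\<close>

definition C_op ::
    "nat \<Rightarrow> nat \<Rightarrow> nat \<Rightarrow> ((nat \<Rightarrow> int) set \<Rightarrow> complex) \<Rightarrow> 'n::nontriv mod_ring
      \<Rightarrow> ('n mod_ring \<Rightarrow> complex) \<Rightarrow> ('n mod_ring \<Rightarrow> complex)" where
  "C_op p r q chi c f = (\<lambda>b.
     chi (unit_class p r q (1 + int p ^ r * to_int_mod_ring c * to_int_mod_ring b)) *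
     f (unit_div b (1 + of_nat (p ^ r) * c * b)))"

definition S_op ::
    "'n::nontriv mod_ring \<Rightarrow> ('n mod_ring \<Rightarrow> complex) \<Rightarrow> ('n mod_ring \<Rightarrow> complex)" where
  "S_op s f = (\<lambda>b. f (b + s))"

definition L_mat :: "nat \<Rightarrow> nat \<Rightarrow> 'n::nontriv mod_ring \<Rightarrow> 'n mod_ring ^ 2 ^ 2" where
  "L_mat p r c = vector [vector [1, 0], vector [of_nat (p ^ r) * c, 1]]"

definition U_mat :: "'n::nontriv mod_ring \<Rightarrow> 'n mod_ring ^ 2 ^ 2" where
  "U_mat s = vector [vector [1, s], vector [0, 1]]"

definition moebius_map :: "'a::comm_ring_1 ^ 2 ^ 2 \<Rightarrow> 'a \<Rightarrow> 'a" where
  "moebius_map M b = unit_div (M $ 1 $ 1 * b + M $ 1 $ 2) (M $ 2 $ 1 * b + M $ 2 $ 2)"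

text \<open>
  \<open>T\<close> is, up to unimodular phases, precomposition with \<open>g\<close>. Precomposition reverses products: if
  \<open>A\<close> and \<open>B\<close> have column actions \<open>g\<close> and \<open>h\<close>, then \<open>A \<circ> B\<close> has column action \<open>h \<circ> g\<close>.
\<close>

definition has_column_action :: "(('a \<Rightarrow> complex) \<Rightarrow> ('a \<Rightarrow> complex)) \<Rightarrow> ('a \<Rightarrow> 'a) \<Rightarrow> bool" where
  "has_column_action T g \<longleftrightarrow>
     (\<exists>\<phi>. (\<forall>b. cmod (\<phi> b) = 1) \<and> (\<forall>f b. T f b = \<phi> b * f (g b)))"

definition map_commutator :: "('a \<Rightarrow> 'a) \<Rightarrow> ('a \<Rightarrow> 'a) \<Rightarrow> 'a \<Rightarrow> 'a" where
  "map_commutator A B = A \<circ> B \<circ> inv_into UNIV A \<circ> inv_into UNIV B"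

definition matrix_commutator :: "'a::comm_ring_1 ^ 2 ^ 2 \<Rightarrow> 'a ^ 2 ^ 2 \<Rightarrow> 'a ^ 2 ^ 2" where
  "matrix_commutator A B = A ** B ** matrix_inv A ** matrix_inv B"

definition operator_commutator ::
    "nat \<Rightarrow> nat \<Rightarrow> nat \<Rightarrow> ((nat \<Rightarrow> int) set \<Rightarrow> complex) \<Rightarrow> 'n::nontriv mod_ring \<Rightarrow> 'n mod_ring
      \<Rightarrow> ('n mod_ring \<Rightarrow> complex) \<Rightarrow> ('n mod_ring \<Rightarrow> complex)" where
  "operator_commutator p r q chi c s = map_commutator (C_op p r q chi c) (S_op s)"

definition is_scalar_operator :: "(('a \<Rightarrow> complex) \<Rightarrow> ('a \<Rightarrow> complex)) \<Rightarrow> bool" where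
  "is_scalar_operator T \<longleftrightarrow> (\<exists>z. \<forall>f b. T f b = z * f b)"

definition is_scalar_matrix :: "'a::comm_ring_1 ^ 2 ^ 2 \<Rightarrow> bool" where
  "is_scalar_matrix M \<longleftrightarrow> (\<exists>k. M = mat k)"

definition vp :: "nat \<Rightarrow> 'n::nontriv mod_ring \<Rightarrow> enat" where
  "vp p x = (if x = 0 then \<infinity> else enat (multiplicity (int p) (to_int_mod_ring x)))"

definition p_power_ideal :: "nat \<Rightarrow> nat \<Rightarrow> 'n::nontriv mod_ring set" where
  "p_power_ideal p \<alpha> = range (\<lambda>x. of_nat (p ^ \<alpha>) * x)"

end

theory Submission
  imports Defs
begin

section \<open>Units and Moebius maps over a commutative ring\<close>

text \<open>Both \<open>C_op\<close> and \<open>S_op\<close> are a unimodular phase times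
  precomposition with a Moebius bijection of \<open>R_q\<close>. Since \<open>eps\<close> is
  nilpotent, the denominators \<open>1 + eps * c * b\<close> are units, so these maps have no poles
  and compose as their matrices do (\<open>moebius_map_mult\<close>). Precomposition reverses
  products: \<open>C S C^-1 S^-1\<close> acts through \<open>U^-1 L^-1 U L\<close>, while the matrix
  \<open>L U L^-1 U^-1\<close> belongs to \<open>S^-1 C^-1 S C\<close>. The matrix criterion and the
  operator criterion are therefore proved separately; they agree because each comes out as
  \<open>t = 0\<close> with \<open>t = eps * c * s\<close>.

  Matrix: the diagonal entries of the commutator differ by \<open>t * (2 + t)\<close>. As
  \<open>p\<close> is odd, \<open>2 + eps * x\<close> is a unit (\<open>unit_two_plus_eps\<close>),
  so a scalar matrix forces \<open>t = 0\<close>, and then it is the identity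
  (\<open>scalar_matrix_commutator_iff\<close>).

  Operator: a scalar weighted composition operator moves no point
  (\<open>scalar_has_column_action_imp_id\<close>), so the two Moebius maps commute; evaluation at 0
  and 1 together with the unit \<open>2 + eps * c\<close> gives \<open>t = 0\<close>
  (\<open>scalar_commutator_imp\<close>). Conversely, let \<open>t = 0\<close>. Then the maps
  commute, and the phases are controlled because \<open>chi\<close> is multiplicative on classes
  (\<open>unit_class_mult\<close>) and sees its argument only modulo \<open>p^(q+r)\<close>
  (\<open>unit_class_eqI\<close>). This yields \<open>S C = z C S\<close> with \<open>z\<close> the
  value of \<open>chi\<close> at \<open>1 + eps * c * s\<close>, so the commutator is the scalar
  \<open>1/z\<close> (\<open>scalar_commutator_if\<close>).

  The rest is divisibility in \<open>Z/p^q\<close>: \<open>eps * x = 0\<close> means that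
  \<open>q\<close> is at most \<open>r\<close> plus the valuation of \<open>x\<close>, and for
  ideals it suffices to test generators.\<close>

lemma unit_mult_left_cancel:
  fixes u :: "'a::comm_ring_1"
  assumes "u dvd 1"
  shows "u * x = u * y \<longleftrightarrow> x = y"
proof
  from assms obtain v where v: "1 = u * v" by (auto simp: dvd_def)
  assume "u * x = u * y"
  then have "v * (u * x) = v * (u * y)" by simp
  moreover have "v * (u * w) = w" for w
    using v by (metis mult.assoc mult.commute mult_1)
  ultimately show "x = y" by simp
qed simp

lemma unit_mult_eq_0_iff:
  fixes u :: "'a::comm_ring_1"
  assumes "u dvd 1"
  shows "u * x = 0 \<longleftrightarrow> x = 0"
  using unit_mult_left_cancel[OF assms, of x 0] by simp

lemma unit_mult:
  fixes u v :: "'a::comm_ring_1"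
  assumes "u dvd 1" and "v dvd 1"
  shows "u * v dvd 1"
  using mult_dvd_mono[OF assms] by simp

text \<open>The geometric series in \<open>- z\<close> breaks off and gives the inverse.\<close>

lemma unit_one_plus_nilpotent:
  fixes z :: "'a::comm_ring_1"
  assumes "z ^ n = 0"
  shows "1 + z dvd 1"
proof -
  have "(- z) ^ n = 0" using assms by (metis mult_zero_right power_minus)
  then have "1 = (1 - (- z)) * (\<Sum>i<n. (- z) ^ i)"
    using one_diff_power_eq[of "- z" n] by simp
  then show ?thesis by (metis diff_minus_eq_add dvd_triv_left)
qed

lemma unit_div_mult:
  fixes y :: "'a::comm_ring_1"
  assumes "y dvd 1"
  shows "unit_div x y * y = x"
proof -
  from assms obtain v where v: "1 = y * v" by (auto simp: dvd_def)
  have "\<exists>!z. z * y = x"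
  proof
    show "(x * v) * y = x" using v by (metis mult.assoc mult.commute mult_1_right)
    show "z = x * v" if "z * y = x" for z
      using that v by (metis mult.assoc mult_1_right)
  qed
  then show ?thesis unfolding unit_div_def by (rule theI')
qed

lemma unit_div_eq_iff:
  fixes y :: "'a::comm_ring_1"
  assumes "y dvd 1"
  shows "unit_div x y = z \<longleftrightarrow> x = z * y"
  using unit_div_mult[OF assms, of x] unit_mult_left_cancel[OF assms, of "unit_div x y" z]
  by (auto simp: mult.commute)

text \<open>Over a ring with non-units an invertible matrix acts in general only on a projective
  line. This condition keeps every value in the ring itself, so that the \<open>unit_div\<close> in
  \<open>moebius_map\<close> is always a genuine quotient.\<close>

definition pole_free :: "'a::comm_ring_1 ^ 2 ^ 2 \<Rightarrow> bool" where
  "pole_free M \<longleftrightarrow> (\<forall>b. M $ 2 $ 1 * b + M $ 2 $ 2 dvd 1)"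

lemma mult_2_2:
  fixes A B :: "'a::comm_ring_1 ^ 2 ^ 2"
  shows "(A ** B) $ i $ j = A $ i $ 1 * B $ 1 $ j + A $ i $ 2 * B $ 2 $ j"
  by (simp add: matrix_matrix_mult_def sum_2)

lemma mat_eq_iff_2_2:
  fixes A B :: "'a ^ 2 ^ 2"
  shows "A = B \<longleftrightarrow> A $ 1 $ 1 = B $ 1 $ 1 \<and> A $ 1 $ 2 = B $ 1 $ 2 \<and>
    A $ 2 $ 1 = B $ 2 $ 1 \<and> A $ 2 $ 2 = B $ 2 $ 2"
  by (auto simp: vec_eq_iff forall_2)

text \<open>In terms of columns, \<open>B\<close> sends \<open>(b, 1)\<close> to
  \<open>y * (m, 1)\<close>, where \<open>m\<close> is the image of \<open>b\<close> and
  \<open>y\<close> its denominator. Applying \<open>A\<close> gives denominator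
  \<open>w * y\<close>, a product of units, and the factor \<open>y\<close> cancels from the
  quotient.\<close>

lemma moebius_map_mult_apply:
  fixes A B :: "'a::comm_ring_1 ^ 2 ^ 2"
  assumes "pole_free A" and "pole_free B"
  shows "(A ** B) $ 2 $ 1 * b + (A ** B) $ 2 $ 2 dvd 1"
    and "moebius_map (A ** B) b = moebius_map A (moebius_map B b)"
proof -
  define m y where "m = moebius_map B b" and "y = B $ 2 $ 1 * b + B $ 2 $ 2"
  define w where "w = A $ 2 $ 1 * m + A $ 2 $ 2"
  have uy: "y dvd 1" and uw: "w dvd 1"
    using assms by (auto simp: pole_free_def y_def w_def)
  have my: "m * y = B $ 1 $ 1 * b + B $ 1 $ 2"
    unfolding m_def moebius_map_def y_def[symmetric] by (rule unit_div_mult[OF uy])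
  have *: "(A ** B) $ i $ 1 * b + (A ** B) $ i $ 2 = (A $ i $ 1 * m + A $ i $ 2) * y" for i
  proof -
    have "(A ** B) $ i $ 1 * b + (A ** B) $ i $ 2 =
      A $ i $ 1 * (B $ 1 $ 1 * b + B $ 1 $ 2) + A $ i $ 2 * y"
      by (simp add: mult_2_2 y_def algebra_simps)
    then show ?thesis by (simp only: my[symmetric]) (simp add: algebra_simps)
  qed
  have den: "(A ** B) $ 2 $ 1 * b + (A ** B) $ 2 $ 2 = w * y"
    using *[of 2] by (simp add: w_def)
  show 1: "(A ** B) $ 2 $ 1 * b + (A ** B) $ 2 $ 2 dvd 1"
    unfolding den by (rule unit_mult[OF uw uy])
  have "moebius_map A m * w = A $ 1 $ 1 * m + A $ 1 $ 2"
    unfolding moebius_map_def w_def[symmetric] by (rule unit_div_mult[OF uw])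
  then have "(A ** B) $ 1 $ 1 * b + (A ** B) $ 1 $ 2 = moebius_map A m * (w * y)"
    using *[of 1] by (simp add: mult.assoc[symmetric])
  then show "moebius_map (A ** B) b = moebius_map A (moebius_map B b)"
    unfolding moebius_map_def[of "A ** B"] using unit_div_eq_iff[OF 1] den m_def by simp
qed

lemma pole_free_mult: "pole_free A \<Longrightarrow> pole_free B \<Longrightarrow> pole_free (A ** B)"
  using moebius_map_mult_apply(1)[of A B] by (auto simp: pole_free_def)

lemma moebius_map_mult:
  "pole_free A \<Longrightarrow> pole_free B \<Longrightarrow> moebius_map (A ** B) = moebius_map A \<circ> moebius_map B"
  using moebius_map_mult_apply(2)[of A B] by (auto simp: fun_eq_iff)

lemma moebius_map_one: "moebius_map (mat 1 :: 'a::comm_ring_1 ^ 2 ^ 2) = id"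
  by (auto simp: fun_eq_iff moebius_map_def mat_def unit_div_eq_iff)

lemma moebius_map_inverse:
  assumes "pole_free A" and "pole_free B" and "A ** B = mat 1" and "B ** A = mat 1"
  shows "bij (moebius_map A)" and "inv_into UNIV (moebius_map A) = moebius_map B"
proof -
  have "moebius_map A \<circ> moebius_map B = id" "moebius_map B \<circ> moebius_map A = id"
    using assms by (metis moebius_map_mult moebius_map_one)+
  then show "bij (moebius_map A)" "inv_into UNIV (moebius_map A) = moebius_map B"
    using o_bij inv_unique_comp by blast+
qed

lemma matrix_inv_eqI:
  fixes A B :: "'a::semiring_1 ^ 'n ^ 'n"
  assumes "A ** B = mat 1" and "B ** A = mat 1"
  shows "matrix_inv A = B"
proof -
  have "A ** matrix_inv A = mat 1"
    using someI[of "\<lambda>C. A ** C = mat 1 \<and> C ** A = mat 1" B] assms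
    by (simp add: matrix_inv_def)
  then have "B ** (A ** matrix_inv A) = B" by simp
  then show ?thesis by (simp add: matrix_mul_assoc assms(2))
qed

section \<open>Weighted composition operators\<close>

lemma has_column_action_comp:
  assumes "has_column_action T g" and "has_column_action T' g'"
  shows "has_column_action (T \<circ> T') (g' \<circ> g)"
proof -
  from assms obtain \<phi> \<psi> where
    \<phi>: "\<And>b. cmod (\<phi> b) = 1" "\<And>f b. T f b = \<phi> b * f (g b)" and
    \<psi>: "\<And>b. cmod (\<psi> b) = 1" "\<And>f b. T' f b = \<psi> b * f (g' b)"
    unfolding has_column_action_def by blast
  then show ?thesis unfolding has_column_action_def
    by (intro exI[of _ "\<lambda>b. \<phi> b * \<psi> (g b)"]) (simp add: norm_mult)
qed

text \<open>Unimodular phases do not vanish, so precomposing with the inverse of \<open>g\<close>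
  and dividing by the transported phase undoes \<open>T\<close>.\<close>

lemma has_column_action_inverse:
  assumes "has_column_action T g" and "bij g"
  shows "bij T" and "has_column_action (inv_into UNIV T) (inv_into UNIV g)"
proof -
  from assms(1) obtain \<phi> where
    \<phi>: "\<And>b. cmod (\<phi> b) = 1" "\<And>f b. T f b = \<phi> b * f (g b)"
    unfolding has_column_action_def by blast
  have nz: "\<phi> b \<noteq> 0" for b using \<phi>(1)[of b] by auto
  have g: "g (inv_into UNIV g b) = b" "inv_into UNIV g (g b) = b" for b
    using assms(2) by (auto simp: bij_is_surj surj_f_inv_f bij_is_inj)
  define T' where "T' f b = inverse (\<phi> (inv_into UNIV g b)) * f (inv_into UNIV g b)" for f :: "'a \<Rightarrow> complex" and b
  have "T \<circ> T' = id" "T' \<circ> T = id"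
    by (auto simp: fun_eq_iff \<phi>(2) T'_def g nz)
  then have *: "bij T" "inv_into UNIV T = T'"
    using o_bij inv_unique_comp by blast+
  then show "bij T" by simp
  show "has_column_action (inv_into UNIV T) (inv_into UNIV g)"
    unfolding *(2) has_column_action_def
    by (intro exI[of _ "\<lambda>b. inverse (\<phi> (inv_into UNIV g b))"]) (simp add: T'_def norm_inverse \<phi>(1))
qed

text \<open>Test on the indicator function of the point \<open>g b\<close>: at a moved point
  \<open>b\<close> the scalar side is 0, while the other side is the nonzero phase.\<close>

lemma scalar_has_column_action_imp_id:
  assumes "has_column_action T g" and "is_scalar_operator T"
  shows "g b = b"
proof (rule ccontr)
  assume ne: "g b \<noteq> b"
  from assms obtain \<phi> z where
    \<phi>: "\<And>b. cmod (\<phi> b) = 1" "\<And>f b. T f b = \<phi> b * f (g b)" and z: "\<And>f b. T f b = z * f b"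
    unfolding has_column_action_def is_scalar_operator_def by blast
  define f :: "'a \<Rightarrow> complex" where "f x = (if x = g b then 1 else 0)" for x
  have "\<phi> b * f (g b) = z * f b" using \<phi>(2) z by metis
  then have "\<phi> b = 0" using ne by (simp add: f_def)
  then show False using \<phi>(1)[of b] by simp
qed

section \<open>Principal units modulo \<open>p\<^sup>q\<^sup>+\<^sup>r\<close>\<close>

text \<open>Allows p-adic integers to be given by unreduced integer sequences that are coherent
  modulo \<open>p^n\<close>; witnesses below are plain integer formulas in this form.\<close>

lemma Zp_carrierI:
  assumes "\<And>n. int p ^ n dvd a (Suc n) - a n" and "0 < p"
  shows "(\<lambda>n. a n mod int p ^ n) \<in> carrier (Zp p)"
proof -
  have "(a (Suc n) mod int p ^ Suc n) mod int p ^ n = a n mod int p ^ n" for n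
  proof -
    have "(a (Suc n) mod int p ^ Suc n) mod int p ^ n = a (Suc n) mod int p ^ n"
      by (rule mod_mod_cancel) simp
    also have "\<dots> = a n mod int p ^ n" using assms(1)[of n] by (simp add: mod_eq_dvd_iff)
    finally show ?thesis .
  qed
  then show ?thesis using assms(2) by (simp add: Zp_def)
qed

lemma Zp_carrier_dvd: "x \<in> carrier (Zp p) \<Longrightarrow> int p ^ n dvd x (Suc n) - x n"
  unfolding Zp_def by (auto simp: mod_eq_dvd_iff[symmetric] simp del: power_Suc)

lemma principal_unitsI:
  assumes "\<And>n. int p ^ n dvd a (Suc n) - a n" and "0 < p"
    and "\<And>n. x n = (1 + int p ^ m * a n) mod int p ^ n"
  shows "x \<in> principal_units p m"
proof -
  have "x = \<one>\<^bsub>Zp p\<^esub> \<oplus>\<^bsub>Zp p\<^esub> Zp_of_int p (int p ^ m) \<otimes>\<^bsub>Zp p\<^esub> (\<lambda>n. a n mod int p ^ n)"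
    by (simp add: fun_eq_iff Zp_def Zp_of_int_def assms(3) mod_simps)
  then show ?thesis
    unfolding principal_units_def using Zp_carrierI[OF assms(1,2)] by blast
qed

lemma principal_unitsE:
  assumes "x \<in> principal_units p m"
  obtains a where "\<And>n. int p ^ n dvd a (Suc n) - a n"
    and "\<And>n. x n = (1 + int p ^ m * a n) mod int p ^ n"
proof -
  from assms obtain a where a: "a \<in> carrier (Zp p)"
    and x: "x = \<one>\<^bsub>Zp p\<^esub> \<oplus>\<^bsub>Zp p\<^esub> Zp_of_int p (int p ^ m) \<otimes>\<^bsub>Zp p\<^esub> a"
    unfolding principal_units_def by blast
  show thesis
  proof (rule that)
    show "int p ^ n dvd a (Suc n) - a n" for n using a by (rule Zp_carrier_dvd)
    show "x n = (1 + int p ^ m * a n) mod int p ^ n" for n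
      by (simp add: x Zp_def Zp_of_int_def mod_simps)
  qed
qed

lemma Zp_of_int_principal_unit:
  "0 < p \<Longrightarrow> Zp_of_int p (1 + int p ^ m * t) \<in> principal_units p m"
  by (rule principal_unitsI[where a = "\<lambda>_. t"]) (auto simp: Zp_of_int_def)

lemma principal_units_mult:
  assumes "x \<in> principal_units p m" and "y \<in> principal_units p m" and "0 < p"
  shows "(\<lambda>n. x n * y n mod int p ^ n) \<in> principal_units p m"
proof -
  obtain a where a: "\<And>n. int p ^ n dvd a (Suc n) - a n"
    "\<And>n. x n = (1 + int p ^ m * a n) mod int p ^ n"
    using principal_unitsE[OF assms(1)] by metis
  obtain b where b: "\<And>n. int p ^ n dvd b (Suc n) - b n"
    "\<And>n. y n = (1 + int p ^ m * b n) mod int p ^ n"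
    using principal_unitsE[OF assms(2)] by metis
  show ?thesis
  \<comment> \<open>The witness is read off from expanding
    \<open>(1 + p^m a)(1 + p^m b)\<close>.\<close>
  proof (rule principal_unitsI[where a = "\<lambda>n. a n + b n + int p ^ m * a n * b n"])
    fix n
    have "a (Suc n) + b (Suc n) + int p ^ m * a (Suc n) * b (Suc n) -
        (a n + b n + int p ^ m * a n * b n) =
      (a (Suc n) - a n) * (1 + int p ^ m * b (Suc n)) + (b (Suc n) - b n) * (1 + int p ^ m * a n)"
      by (simp add: algebra_simps)
    then show "int p ^ n dvd a (Suc n) + b (Suc n) + int p ^ m * a (Suc n) * b (Suc n) -
        (a n + b n + int p ^ m * a n * b n)"
      using a(1) b(1) by simp
    show "x n * y n mod int p ^ n =
        (1 + int p ^ m * (a n + b n + int p ^ m * a n * b n)) mod int p ^ n"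
      unfolding a b mod_mult_eq by (rule arg_cong[where f = "\<lambda>z. z mod _"]) (simp add: algebra_simps)
  qed (fact assms)
qed

text \<open>
  The quotient \<open>k / l\<close> is \<open>1 + p^m t / l\<close>, where \<open>1 / l\<close> is a truncated geometric series at each
  level since \<open>l = 1 - p u\<close>.
\<close>

lemma principal_unit_quotient:
  assumes "k = l + int p ^ m * t" and "l = 1 - int p * u" and "0 < p"
  shows "\<exists>h \<in> principal_units p m. \<forall>n. h n * l mod int p ^ n = k mod int p ^ n"
proof -
  define a where "a n = t * (\<Sum>i<n. (int p * u) ^ i)" for n :: nat
  have la: "l * a n = t * (1 - (int p * u) ^ n)" for n
    unfolding a_def assms(2) one_diff_power_eq by (simp add: algebra_simps)
  define h where "h n = (1 + int p ^ m * a n) mod int p ^ n" for n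
  have "h \<in> principal_units p m"
  proof (rule principal_unitsI)
    show "int p ^ n dvd a (Suc n) - a n" for n
      by (simp add: a_def algebra_simps power_mult_distrib)
  qed (auto simp: h_def assms(3))
  moreover have "h n * l mod int p ^ n = k mod int p ^ n" for n
  proof -
    have "(1 + int p ^ m * a n) * l - k = int p ^ n * (- (int p ^ m * t * u ^ n))"
    proof -
      have "(1 + int p ^ m * a n) * l - k = int p ^ m * (l * a n - t)"
        by (simp add: assms(1) algebra_simps)
      then show ?thesis unfolding la by (simp add: algebra_simps power_mult_distrib)
    qed
    then have "(1 + int p ^ m * a n) * l mod int p ^ n = k mod int p ^ n"
      by (simp add: mod_eq_dvd_iff)
    then show ?thesis by (simp only: h_def mod_mult_left_eq)
  qed
  ultimately show ?thesis by blast
qed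

lemma unit_class_image:
  "unit_class p r q k = (\<lambda>h n. h n * k mod int p ^ n) ` principal_units p (q + r)"
  by (auto simp: unit_class_def r_coset_def principal_unit_group_def units_of_def Zp_def
      Zp_of_int_def mod_simps image_def)

text \<open>By \<open>principal_unit_quotient\<close>, \<open>k = g l\<close> with \<open>g\<close>
  in the subgroup \<open>H\<close> being factored out, so \<open>H k = H g l\<close> lies in
  \<open>H l\<close>. The congruence \<open>l = 1\<close> modulo \<open>p\<close> is what makes
  division by \<open>l\<close> possible.\<close>

lemma unit_class_subset:
  assumes "int p ^ (q + r) dvd k - l" and "int p dvd l - 1" and "0 < p"
  shows "unit_class p r q k \<subseteq> unit_class p r q l"
proof -
  from assms obtain t where t: "k = l + int p ^ (q + r) * t" by (metis dvd_def diff_eq_eq add.commute)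
  from assms obtain u where "l - 1 = int p * u" by (auto simp: dvd_def)
  then have "l = 1 - int p * (- u)" by simp
  from principal_unit_quotient[OF t this assms(3)]
  obtain g where g: "g \<in> principal_units p (q + r)" "\<forall>n. g n * l mod int p ^ n = k mod int p ^ n"
    by (rule bexE)
  show ?thesis unfolding unit_class_image
  proof (rule image_subsetI)
    fix h assume h: "h \<in> principal_units p (q + r)"
    have "h n * k mod int p ^ n = (h n * g n mod int p ^ n) * l mod int p ^ n" for n
    proof -
      have "h n * k mod int p ^ n = h n * (g n * l mod int p ^ n) mod int p ^ n"
        unfolding g(2)[rule_format] mod_mult_right_eq ..
      then show ?thesis by (simp only: mod_mult_right_eq mod_mult_left_eq mult.assoc)
    qed
    then show "(\<lambda>n. h n * k mod int p ^ n) \<in>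
        (\<lambda>h n. h n * l mod int p ^ n) ` principal_units p (q + r)"
      by (intro image_eqI[OF _ principal_units_mult[OF h g(1) assms(3)]]) (rule ext)
  qed
qed

lemma unit_class_eqI:
  assumes "int p ^ (q + r) dvd k - l" and "int p dvd l - 1" and "0 < p" and "1 \<le> q"
  shows "unit_class p r q k = unit_class p r q l"
proof (rule equalityI)
  have 1: "int p ^ (q + r) dvd l - k" using assms(1) by (simp add: dvd_diff_commute)
  \<comment> \<open>The reverse inclusion divides by \<open>k\<close>, so \<open>k\<close> must also
    be 1 modulo \<open>p\<close>; it inherits this from \<open>l\<close>.\<close>
  have "int p dvd int p ^ (q + r)" using assms(4) by (intro dvd_power) auto
  then have "int p dvd k - l" using assms(1) by (rule dvd_trans)
  then have "int p dvd (k - l) + (l - 1)" using assms(2) by (rule dvd_add)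
  then have 2: "int p dvd k - 1" by simp
  show "unit_class p r q k \<subseteq> unit_class p r q l" by (rule unit_class_subset) fact+
  show "unit_class p r q l \<subseteq> unit_class p r q k" by (rule unit_class_subset) fact+
qed

text \<open>Computed directly on sets: commutativity and closure of \<open>H\<close> put
  \<open>(H k)(H l)\<close> inside \<open>H (k l)\<close>, and 1 in \<open>H\<close> gives the other
  inclusion.\<close>

lemma unit_class_mult:
  assumes "0 < p"
  shows "unit_class p r q k \<otimes>\<^bsub>unit_quotient p r q\<^esub> unit_class p r q l = unit_class p r q (k * l)"
    (is "?L = ?R")
proof (rule Set.set_eqI)
  fix z
  let ?H = "principal_units p (q + r)"
  have "z \<in> ?L \<longleftrightarrow>
      (\<exists>h \<in> ?H. \<exists>g \<in> ?H. z = (\<lambda>n. (h n * k mod int p ^ n) * (g n * l mod int p ^ n) mod int p ^ n))"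
    by (simp add: unit_quotient_def FactGroup_def set_mult_def principal_unit_group_def
        units_of_def Zp_def unit_class_image)
  also have "\<dots> \<longleftrightarrow>
      (\<exists>h \<in> ?H. \<exists>g \<in> ?H. z = (\<lambda>n. (h n * g n mod int p ^ n) * (k * l) mod int p ^ n))"
  proof -
    have "(h n * k mod int p ^ n) * (g n * l mod int p ^ n) mod int p ^ n =
        (h n * g n mod int p ^ n) * (k * l) mod int p ^ n" for h g :: "nat \<Rightarrow> int" and n
    proof -
      have "(h n * k mod int p ^ n) * (g n * l mod int p ^ n) mod int p ^ n =
          (h n * k) * (g n * l) mod int p ^ n"
        by (rule mod_mult_eq)
      also have "\<dots> = (h n * g n) * (k * l) mod int p ^ n" by (simp only: mult_ac)
      finally show ?thesis by (simp only: mod_mult_left_eq)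
    qed
    then show ?thesis by (simp only:)
  qed
  also have "\<dots> \<longleftrightarrow> z \<in> ?R"
  proof
    assume "\<exists>h \<in> ?H. \<exists>g \<in> ?H. z = (\<lambda>n. (h n * g n mod int p ^ n) * (k * l) mod int p ^ n)"
    then obtain h g where h: "h \<in> ?H" and g: "g \<in> ?H"
      and z: "z = (\<lambda>n. (h n * g n mod int p ^ n) * (k * l) mod int p ^ n)"
      by (elim bexE)
    show "z \<in> ?R" unfolding unit_class_image z
      by (rule image_eqI[OF refl principal_units_mult[OF h g assms]])
  next
    assume "z \<in> ?R"
    then obtain h where h: "h \<in> ?H" and z: "z = (\<lambda>n. h n * (k * l) mod int p ^ n)"
      unfolding unit_class_image by (elim imageE)
    have one: "Zp_of_int p 1 \<in> ?H" using Zp_of_int_principal_unit[OF assms, of _ 0] by simp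
    have "z = (\<lambda>n. (h n * Zp_of_int p 1 n mod int p ^ n) * (k * l) mod int p ^ n)"
      unfolding z Zp_of_int_def mod_mult_right_eq mod_mult_left_eq mult_1_right ..
    with h one show "\<exists>h \<in> ?H. \<exists>g \<in> ?H. z = (\<lambda>n. (h n * g n mod int p ^ n) * (k * l) mod int p ^ n)"
      by (intro bexI)
  qed
  finally show "z \<in> ?L \<longleftrightarrow> z \<in> ?R" .
qed

lemma unit_class_carrier:
  assumes "0 < p" and "int p ^ r dvd k - 1"
  shows "unit_class p r q k \<in> carrier (unit_quotient p r q)"
proof -
  from assms obtain t where "k = 1 + int p ^ r * t" by (metis dvd_def diff_eq_eq add.commute)
  then have "Zp_of_int p k \<in> principal_units p r" using Zp_of_int_principal_unit assms by simp
  then show ?thesis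
    by (auto simp: unit_quotient_def FactGroup_def RCOSETS_def unit_class_def principal_unit_group_def)
qed

lemma character_norm:
  assumes "faithful_character p r q chi" and "0 < p" and "int p ^ r dvd k - 1"
  shows "cmod (chi (unit_class p r q k)) = 1"
proof -
  have "chi (unit_class p r q k) \<in> carrier roots_of_unity_group"
    using assms unit_class_carrier[OF assms(2,3)] by (auto simp: faithful_character_def hom_def)
  then obtain n where "n > 0" "chi (unit_class p r q k) ^ n = 1"
    by (auto simp: roots_of_unity_group_def)
  then show ?thesis using power_eq_imp_eq_norm[of _ n 1] by simp
qed

lemma character_mult:
  assumes "faithful_character p r q chi" and "0 < p"
    and "int p ^ r dvd k - 1" and "int p ^ r dvd l - 1"
  shows "chi (unit_class p r q (k * l)) = chi (unit_class p r q k) * chi (unit_class p r q l)"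
proof -
  have "chi \<in> hom (unit_quotient p r q) roots_of_unity_group"
    using assms(1) by (simp add: faithful_character_def)
  from hom_mult[OF this unit_class_carrier[OF assms(2,3)] unit_class_carrier[OF assms(2,4)]]
  show ?thesis by (simp add: unit_class_mult[OF assms(2)] roots_of_unity_group_def)
qed

section \<open>The commutator over \<open>Z/p\<^sup>qZ\<close>\<close>

lemma of_int_mod_ring_eq_0_iff: "(of_int k :: 'n::nontriv mod_ring) = 0 \<longleftrightarrow> int CARD('n) dvd k"
  unfolding of_int_of_int_mod_ring by transfer (simp add: dvd_eq_mod_eq_0)

lemma of_int_to_int_mod_ring: "of_int (to_int_mod_ring x) = (x :: 'n::nontriv mod_ring)"
  by (simp add: of_int_of_int_mod_ring)

lemma matrix_inv_U_mat: "matrix_inv (U_mat s) = U_mat (- s)"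
  by (rule matrix_inv_eqI) (simp_all add: U_mat_def mat_eq_iff_2_2 mult_2_2 mat_def)

lemma matrix_inv_L_mat: "matrix_inv (L_mat p r c) = L_mat p r (- c)"
  by (rule matrix_inv_eqI) (simp_all add: L_mat_def mat_eq_iff_2_2 mult_2_2 mat_def)

lemma matrix_commutator_L_U:
  assumes "e = of_nat (p ^ r)"
  shows "matrix_commutator (L_mat p r c) (U_mat s) =
    vector [vector [1 - e * c * s, e * c * s\<^sup>2],
            vector [- (e\<^sup>2 * c\<^sup>2 * s), 1 + e * c * s + e\<^sup>2 * c\<^sup>2 * s\<^sup>2]]"
proof -
  have "L_mat p r c = vector [vector [1, 0], vector [e * c, 1]]" for c
    by (simp only: L_mat_def assms)
  then show ?thesis
    unfolding matrix_commutator_def matrix_inv_U_mat matrix_inv_L_mat mat_eq_iff_2_2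
    by (simp add: mult_2_2 U_mat_def algebra_simps power2_eq_square)
qed

lemma pole_free_U_mat: "pole_free (U_mat s)"
  by (simp add: pole_free_def U_mat_def)

lemma moebius_map_U_mat: "moebius_map (U_mat s) = (\<lambda>b. b + s)"
  by (simp add: fun_eq_iff moebius_map_def U_mat_def unit_div_eq_iff)

lemma moebius_U_mat_inverse:
  fixes s :: "'a::nontriv mod_ring"
  shows "bij (moebius_map (U_mat s))" "inv_into UNIV (moebius_map (U_mat s)) = moebius_map (U_mat (- s))"
proof -
  have "U_mat t ** U_mat (- t) = mat 1" for t :: "'a mod_ring"
    by (simp add: U_mat_def mat_eq_iff_2_2 mult_2_2 mat_def)
  from moebius_map_inverse[OF pole_free_U_mat pole_free_U_mat this[of s] this[of "- s", simplified]]
  show "bij (moebius_map (U_mat s))"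
    and "inv_into UNIV (moebius_map (U_mat s)) = moebius_map (U_mat (- s))" .
qed

lemma S_op_column_action: "has_column_action (S_op s) (moebius_map (U_mat s))"
  unfolding has_column_action_def moebius_map_U_mat S_op_def
  by (intro exI[of _ "\<lambda>_. 1"]) simp

section \<open>Units, the matrix criterion and the valuation for \<open>eps = p^r\<close> in
  \<open>Z/p^q\<close>\<close>

context
  fixes p r q :: nat and eps :: "'n::nontriv mod_ring"
  assumes prime_p: "prime p" and odd_p: "odd p" and r: "1 \<le> r" and q: "1 \<le> q"
    and card: "CARD('n) = p ^ q" and eps: "eps = of_nat (p ^ r)"
begin

lemma p_pos: "0 < p"
  using prime_p by (rule prime_gt_0_nat)

lemma of_int_eq_0_iff_p_power_dvd: "(of_int k :: 'n mod_ring) = 0 \<longleftrightarrow> int p ^ q dvd k"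
  by (simp add: of_int_mod_ring_eq_0_iff card)

lemma of_nat_p_power_eq_0_iff: "(of_nat (p ^ n) :: 'n mod_ring) = 0 \<longleftrightarrow> q \<le> n"
proof -
  have "1 < int p" using prime_gt_1_nat[OF prime_p] by simp
  then have "int p ^ q dvd int p ^ n \<longleftrightarrow> q \<le> n" by (auto simp: dvd_power_iff)
  then show ?thesis using of_int_eq_0_iff_p_power_dvd[of "int p ^ n"] by simp
qed

text \<open>\<open>eps\<close> is nilpotent: \<open>r >= 1\<close> gives \<open>r * q >= q\<close>,
  hence \<open>eps ^ q = 0\<close>.\<close>

lemma unit_one_plus_eps: "1 + eps * x dvd 1"
proof (rule unit_one_plus_nilpotent)
  have "eps ^ q = of_nat (p ^ (r * q))" by (simp add: eps power_mult)
  also have "\<dots> = 0" using r by (subst of_nat_p_power_eq_0_iff) simp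
  finally show "(eps * x) ^ q = 0" by (simp add: power_mult_distrib)
qed

text \<open>Oddness of \<open>p\<close> enters here: \<open>p^q + 1 = 2 * k\<close> becomes
  \<open>1 = 2 * k\<close> in the ring, so 2 is a unit and can be factored out, leaving
  \<open>1 + eps * (k * x)\<close>.\<close>

lemma unit_two_plus_eps: "2 + eps * x dvd 1"
proof -
  have "even (p ^ q + 1)" using odd_p by simp
  then obtain k where "p ^ q + 1 = 2 * k" by (rule evenE)
  then have "of_nat (CARD('n) + 1) = (of_nat (2 * k) :: 'n mod_ring)" by (simp only: card)
  then have k: "1 = (2 :: 'n mod_ring) * of_nat k"
    by (simp only: of_nat_add of_nat_card_eq_0 of_nat_mult) simp
  have "2 + eps * x = 2 + (2 * of_nat k) * (eps * x)" unfolding k[symmetric] by simp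
  also have "\<dots> = 2 * (1 + eps * (of_nat k * x))" by (simp add: algebra_simps)
  finally have *: "2 + eps * x = 2 * (1 + eps * (of_nat k * x))" .
  show ?thesis unfolding *
    by (rule unit_mult[OF _ unit_one_plus_eps]) (use k in \<open>auto intro: dvdI\<close>)
qed

lemma pole_free_L_mat: "pole_free (L_mat p r c :: 'n mod_ring ^ 2 ^ 2)"
  using unit_one_plus_eps by (simp add: pole_free_def L_mat_def eps add.commute mult.assoc)

lemma moebius_map_L_mat: "moebius_map (L_mat p r c) b = unit_div b (1 + eps * c * b)"
  by (simp add: moebius_map_def L_mat_def eps add.commute)

lemma moebius_L_mat_inverse:
  fixes c :: "'n mod_ring"
  shows "bij (moebius_map (L_mat p r c))"
    and "inv_into UNIV (moebius_map (L_mat p r c)) = moebius_map (L_mat p r (- c))"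
proof -
  have "L_mat p r d ** L_mat p r (- d) = mat 1" for d :: "'n mod_ring"
    by (simp add: L_mat_def mat_eq_iff_2_2 mult_2_2 mat_def)
  from moebius_map_inverse[OF pole_free_L_mat pole_free_L_mat this[of c] this[of "- c", simplified]]
  show "bij (moebius_map (L_mat p r c))"
    and "inv_into UNIV (moebius_map (L_mat p r c)) = moebius_map (L_mat p r (- c))" .
qed

lemma map_commutator_L_U:
  fixes c s :: "'n mod_ring"
  shows "map_commutator (moebius_map (L_mat p r c)) (moebius_map (U_mat s)) =
    moebius_map (matrix_commutator (L_mat p r c) (U_mat s))"
  by (simp add: map_commutator_def matrix_commutator_def matrix_inv_U_mat matrix_inv_L_mat
      moebius_U_mat_inverse moebius_L_mat_inverse moebius_map_mult pole_free_mult
      pole_free_L_mat pole_free_U_mat)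

text \<open>Equality of the diagonal entries says \<open>(2 + t) * t = 0\<close> with
  \<open>2 + t\<close> a unit. Conversely the commutator differs from the identity only by multiples
  of \<open>t\<close>.\<close>

lemma scalar_matrix_commutator_iff:
  fixes c s :: "'n mod_ring"
  shows "is_scalar_matrix (matrix_commutator (L_mat p r c) (U_mat s)) \<longleftrightarrow> eps * c * s = 0"
proof -
  define t where "t = eps * c * s"
  have eq: "matrix_commutator (L_mat p r c) (U_mat s) =
      vector [vector [1 - t, t * s], vector [- (t * eps * c), 1 + t + t * t]]"
    unfolding matrix_commutator_L_U[OF eps] mat_eq_iff_2_2
    by (simp add: t_def power2_eq_square algebra_simps)
  have "t = 0" if "1 - t = k" and "1 + t + t * t = k" for k
  proof -
    have "(2 + eps * (c * s)) * t = (1 + t + t * t) - (1 - t)"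
      by (simp add: t_def algebra_simps)
    then have "(2 + eps * (c * s)) * t = 0" using that by simp
    then show "t = 0" by (simp add: unit_mult_eq_0_iff[OF unit_two_plus_eps])
  qed
  then show ?thesis unfolding is_scalar_matrix_def eq t_def[symmetric] mat_eq_iff_2_2
    by (auto simp: mat_def)
qed

text \<open>For \<open>x\<close> nonzero, lift to its integer representative \<open>X\<close>; then
  \<open>p^q\<close> divides \<open>p^r X\<close> iff \<open>q\<close> is at most \<open>r\<close>
  plus the multiplicity of \<open>p\<close> in \<open>X\<close>. The difference is taken in the
  reals, so it may be negative, and then the condition always holds.\<close>

lemma eps_mult_eq_0_iff_vp: "eps * x = 0 \<longleftrightarrow> ereal_of_enat (vp p x) \<ge> ereal (real q - real r)"
proof (cases "x = 0")
  case True
  then show ?thesis by (simp add: vp_def)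
next
  case False
  define X where "X = to_int_mod_ring x"
  have X: "of_int X = x" by (simp add: X_def of_int_to_int_mod_ring)
  with False have "X \<noteq> 0" by auto
  have pe: "prime_elem (int p)" using prime_p by simp
  have "eps * x = of_int (int p ^ r * X)" by (simp add: eps X)
  then have "eps * x = 0 \<longleftrightarrow> int p ^ q dvd int p ^ r * X"
    by (simp only: of_int_eq_0_iff_p_power_dvd)
  also have "\<dots> \<longleftrightarrow> q \<le> multiplicity (int p) (int p ^ r * X)"
    using pe \<open>X \<noteq> 0\<close> p_pos by (intro power_dvd_iff_le_multiplicity) (auto simp: prime_elem_not_unit)
  also have "multiplicity (int p) (int p ^ r * X) = r + multiplicity (int p) X"
    using pe \<open>X \<noteq> 0\<close> p_pos
    by (simp add: prime_elem_multiplicity_mult_distrib prime_elem_multiplicity_power_distrib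
        multiplicity_same_power prime_elem_not_unit)
  finally show ?thesis using False by (simp add: vp_def X_def) linarith
qed

section \<open>The operator commutator: scalar criterion and rectangles\<close>

context
  fixes chi :: "(nat \<Rightarrow> int) set \<Rightarrow> complex"
  assumes chi: "faithful_character p r q chi"
begin

lemma C_op_column_action:
  fixes c :: "'n mod_ring"
  shows "has_column_action (C_op p r q chi c) (moebius_map (L_mat p r c))"
  unfolding has_column_action_def C_op_def moebius_map_L_mat eps[symmetric]
  using character_norm[OF chi p_pos]
  by (intro exI[of _ "\<lambda>b. chi (unit_class p r q (1 + int p ^ r * to_int_mod_ring c * to_int_mod_ring b))"])
    (simp add: mult.assoc)

lemmas C_op_inverse =
  has_column_action_inverse[OF C_op_column_action moebius_L_mat_inverse(1), unfolded moebius_L_mat_inverse(2)]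

lemmas S_op_inverse =
  has_column_action_inverse[OF S_op_column_action moebius_U_mat_inverse(1), unfolded moebius_U_mat_inverse(2)]

text \<open>Column actions compose in the opposite order, so the operator word over
  \<open>L U L^-1 U^-1\<close> is this reversed one;
  \<open>operator_commutator_column_action\<close> gives the matrix word over
  \<open>C S C^-1 S^-1\<close> itself.\<close>

lemma reversed_commutator_column_action:
  fixes c s :: "'n mod_ring"
  shows "has_column_action
    (inv_into UNIV (S_op s) \<circ> inv_into UNIV (C_op p r q chi c) \<circ> S_op s \<circ> C_op p r q chi c)
    (moebius_map (matrix_commutator (L_mat p r c) (U_mat s)))"
proof -
  have "has_column_action
      (inv_into UNIV (S_op s) \<circ> inv_into UNIV (C_op p r q chi c) \<circ> S_op s \<circ> C_op p r q chi c)
      (moebius_map (L_mat p r c) \<circ> (moebius_map (U_mat s) \<circ>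
        (moebius_map (L_mat p r (- c)) \<circ> moebius_map (U_mat (- s)))))"
    by (intro has_column_action_comp C_op_inverse S_op_inverse C_op_column_action S_op_column_action)
  then show ?thesis
    by (simp add: matrix_commutator_def matrix_inv_U_mat matrix_inv_L_mat moebius_map_mult
        pole_free_mult pole_free_L_mat pole_free_U_mat comp_assoc)
qed

lemma operator_commutator_column_action:
  fixes c s :: "'n mod_ring"
  shows "has_column_action (operator_commutator p r q chi c s)
    (moebius_map (matrix_inv (U_mat s) ** matrix_inv (L_mat p r c) ** U_mat s ** L_mat p r c))"
proof -
  have "has_column_action (operator_commutator p r q chi c s)
      (moebius_map (U_mat (- s)) \<circ> (moebius_map (L_mat p r (- c)) \<circ>
        (moebius_map (U_mat s) \<circ> moebius_map (L_mat p r c))))"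
    unfolding operator_commutator_def map_commutator_def
    by (intro has_column_action_comp C_op_inverse S_op_inverse C_op_column_action S_op_column_action)
  then show ?thesis
    by (simp add: matrix_inv_U_mat matrix_inv_L_mat moebius_map_mult
        pole_free_mult pole_free_L_mat pole_free_U_mat comp_assoc)
qed

text \<open>
  A scalar commutator forces the two Moebius maps to commute. At \<open>b = 0\<close> this gives \<open>\<epsilon>cs\<^sup>2 = 0\<close>, and
  then at \<open>b = 1\<close> it gives \<open>(2 + \<epsilon>c)\<epsilon>cs = 0\<close>.
\<close>

lemma scalar_commutator_imp:
  fixes c s :: "'n mod_ring"
  assumes "is_scalar_operator (operator_commutator p r q chi c s)"
  shows "eps * c * s = 0"
proof -
  define l where "l = moebius_map (L_mat p r c)"
  define t where "t = eps * c * s"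
  have ll: "l (moebius_map (L_mat p r (- c)) b) = b" for b
    using moebius_L_mat_inverse[of c] by (metis bij_inv_eq_iff l_def)
  have "moebius_map (matrix_inv (U_mat s) ** matrix_inv (L_mat p r c) ** U_mat s ** L_mat p r c) b = b"
    for b
    by (rule scalar_has_column_action_imp_id[OF operator_commutator_column_action assms])
  then have "moebius_map (L_mat p r (- c)) (l b + s) + - s = b" for b
    by (simp add: matrix_inv_U_mat matrix_inv_L_mat moebius_map_mult
        pole_free_mult pole_free_L_mat pole_free_U_mat moebius_map_U_mat l_def)
  then have comm: "l b + s = l (b + s)" for b
    using ll by (metis add_uminus_conv_diff diff_eq_eq)
  have l: "l b * (1 + eps * (c * b)) = b" for b
    unfolding l_def moebius_map_L_mat using unit_div_mult[OF unit_one_plus_eps] by (simp add: mult.assoc)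
  \<comment> \<open>Clearing the two unit denominators turns commutation into a polynomial identity
    in \<open>b\<close>.\<close>
  have *: "(b + s * (1 + eps * (c * b))) * (1 + eps * (c * (b + s))) = (b + s) * (1 + eps * (c * b))" for b
  proof -
    have "(l b * (1 + eps * (c * b)) + s * (1 + eps * (c * b))) * (1 + eps * (c * (b + s))) =
      (l (b + s) * (1 + eps * (c * (b + s)))) * (1 + eps * (c * b))"
      unfolding comm[symmetric] by (simp only: algebra_simps)
    then show ?thesis unfolding l .
  qed
  have ts: "t * s = 0"
    using *[of 0] by (simp add: t_def algebra_simps)
  have "(1 + s * (1 + eps * c)) * (1 + eps * (c * (1 + s))) - (1 + s) * (1 + eps * c) =
      t * (2 + eps * c) + (t * s) * (1 + eps * c)"
    by (simp add: t_def algebra_simps)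
  then have "0 = t * (2 + eps * c) + (t * s) * (1 + eps * c)"
    unfolding *[of 1, unfolded mult_1_right] diff_self .
  then have "(2 + eps * c) * t = 0"
    unfolding ts by (simp add: mult.commute)
  then show ?thesis by (simp add: unit_mult_eq_0_iff[OF unit_two_plus_eps] t_def)
qed

text \<open>
  If \<open>\<epsilon>cs = 0\<close> then \<open>1 + \<epsilon>c(b + s)\<close> and \<open>(1 + \<epsilon>cb)(1 + \<epsilon>cs)\<close> differ by a multiple of \<open>\<epsilon> p\<^sup>q\<close>, so the
  phases of \<open>S C\<close> and \<open>C S\<close> differ by the constant factor \<open>\<chi>(1 + \<epsilon>cs)\<close>.
\<close>

lemma scalar_commutator_if:
  fixes c s :: "'n mod_ring"
  assumes cs: "eps * c * s = 0"
  shows "is_scalar_operator (operator_commutator p r q chi c s)"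
proof -
  define X where "X b = chi (unit_class p r q (1 + int p ^ r * to_int_mod_ring c * to_int_mod_ring b))"
    for b :: "'n mod_ring"
  have "cmod (X s) = 1"
    unfolding X_def by (rule character_norm[OF chi p_pos]) (simp add: mult.assoc)
  then have Xs: "X s \<noteq> 0" by auto
  have X_add: "X (b + s) = X b * X s" for b
  proof -
    define c' b' s' t' where "c' = to_int_mod_ring c" and "b' = to_int_mod_ring b"
      and "s' = to_int_mod_ring s" and "t' = to_int_mod_ring (b + s)"
    note defs = c'_def b'_def s'_def t'_def
    \<comment> \<open>Canonical representatives add only modulo \<open>p^q\<close>. In the expansion
      below the outer factor \<open>p^r\<close> raises both this error and the cross term to
      multiples of \<open>p^(q+r)\<close>.\<close>
    have "of_int (b' + s' - t') = (0 :: 'n mod_ring)"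
      by (simp add: defs of_int_to_int_mod_ring)
    then have 1: "int p ^ q dvd b' + s' - t'" by (simp only: of_int_eq_0_iff_p_power_dvd)
    have "of_int (int p ^ r * c' * s') = (0 :: 'n mod_ring)"
      using cs by (simp add: defs of_int_to_int_mod_ring eps)
    then have 2: "int p ^ q dvd int p ^ r * c' * s'" by (simp only: of_int_eq_0_iff_p_power_dvd)
    have "(1 + int p ^ r * c' * b') * (1 + int p ^ r * c' * s') - (1 + int p ^ r * c' * t') =
      int p ^ r * (c' * (b' + s' - t') + c' * b' * (int p ^ r * c' * s'))"
      by (simp add: algebra_simps)
    moreover have "int p ^ (q + r) dvd \<dots>"
      unfolding power_add mult.commute[of "int p ^ q"] using 1 2 by (intro mult_dvd_mono) auto
    ultimately have 3: "int p ^ (q + r) dvd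
      (1 + int p ^ r * c' * b') * (1 + int p ^ r * c' * s') - (1 + int p ^ r * c' * t')" by simp
    have "int p dvd int p ^ r" using r by (intro dvd_power) auto
    then have 4: "int p dvd (1 + int p ^ r * c' * t') - 1" by (simp add: mult.assoc)
    have "unit_class p r q (1 + int p ^ r * c' * t') =
      unit_class p r q ((1 + int p ^ r * c' * b') * (1 + int p ^ r * c' * s'))"
      using unit_class_eqI[OF 3 4 p_pos q] by simp
    then show ?thesis
      unfolding X_def defs[symmetric]
      using character_mult[OF chi p_pos, of "1 + int p ^ r * c' * b'" "1 + int p ^ r * c' * s'"]
      by (simp add: mult.assoc)
  qed
  \<comment> \<open>The two Moebius maps commute: since \<open>eps * c * s = 0\<close>, the shift
    leaves the denominator unchanged, and multiplying \<open>s\<close> by that denominator gives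
    \<open>s\<close> back.\<close>
  have quot: "unit_div b (1 + eps * c * b) + s = unit_div (b + s) (1 + eps * c * (b + s))" for b
  proof -
    have u: "1 + eps * c * x dvd 1" for x using unit_one_plus_eps[of "c * x"] by (simp add: mult.assoc)
    have *: "1 + eps * c * (b + s) = 1 + eps * c * b" using cs by (simp add: algebra_simps)
    have "s * (1 + eps * c * b) = s + eps * c * s * b" by (simp add: algebra_simps)
    then have "b + s = (unit_div b (1 + eps * c * b) + s) * (1 + eps * c * b)"
      using cs by (simp add: distrib_right unit_div_mult[OF u])
    then have "unit_div (b + s) (1 + eps * c * b) = unit_div b (1 + eps * c * b) + s"
      by (simp only: unit_div_eq_iff[OF u])
    then show ?thesis unfolding * by (rule sym)
  qed
  have C: "C_op p r q chi c f b = X b * f (unit_div b (1 + eps * c * b))" for f b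
    by (simp add: C_op_def X_def eps)
  have S: "S_op s f b = f (b + s)" for f :: "'n mod_ring \<Rightarrow> complex" and b
    by (simp add: S_op_def)
  have SC: "S_op s (C_op p r q chi c f) = (\<lambda>b. X s * C_op p r q chi c (S_op s f) b)" for f
    by (simp add: fun_eq_iff C S X_add quot)
  have "operator_commutator p r q chi c s f b = inverse (X s) * f b" for f b
  proof -
    \<comment> \<open>Applying \<open>S C = X s * C S\<close> to \<open>g = C^-1 S^-1 f\<close>
      turns the left side into \<open>f\<close> and exhibits the commutator as division by
      \<open>X s\<close>.\<close>
    define g where "g = inv_into UNIV (C_op p r q chi c) (inv_into UNIV (S_op s) f)"
    have "C_op p r q chi c g = inv_into UNIV (S_op s) f"
      unfolding g_def by (rule surj_f_inv_f[OF bij_is_surj[OF C_op_inverse(1)]])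
    then have "S_op s (C_op p r q chi c g) = f"
      by (simp add: surj_f_inv_f[OF bij_is_surj[OF S_op_inverse(1)]])
    then have "f b = X s * C_op p r q chi c (S_op s g) b" by (simp add: SC fun_eq_iff)
    then show ?thesis
      by (simp add: operator_commutator_def map_commutator_def g_def Xs)
  qed
  then show ?thesis unfolding is_scalar_operator_def by blast
qed

lemma scalar_commutator_iff:
  fixes c s :: "'n mod_ring"
  shows "is_scalar_operator (operator_commutator p r q chi c s) \<longleftrightarrow> eps * c * s = 0"
  using scalar_commutator_imp scalar_commutator_if by blast

text \<open>The single pair \<open>c = s = 1\<close> decides, since there the criterion reads
  \<open>eps = 0\<close>.\<close>

lemma scalar_commutator_all_iff:
  "(\<forall>c s :: 'n mod_ring. is_scalar_operator (operator_commutator p r q chi c s)) \<longleftrightarrow> q \<le> r"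
proof -
  have "(\<forall>c s. eps * c * s = 0) \<longleftrightarrow> eps = 0" by (metis mult_1_right mult_zero_left)
  then show ?thesis unfolding scalar_commutator_iff by (simp only: eps of_nat_p_power_eq_0_iff)
qed

text \<open>On the rectangle the criterion reads
  \<open>p^(r + \<alpha> + \<beta>) * (x * y) = 0\<close> for all \<open>x\<close> and
  \<open>y\<close>; the generators \<open>x = y = 1\<close> decide.\<close>

lemma scalar_commutator_rectangle_iff:
  "(\<forall>c \<in> (p_power_ideal p \<alpha> :: 'n mod_ring set). \<forall>s \<in> (p_power_ideal p \<beta> :: 'n mod_ring set).
     is_scalar_operator (operator_commutator p r q chi c s)) \<longleftrightarrow> r + \<alpha> + \<beta> \<ge> q"
proof -
  have eq: "eps * (of_nat (p ^ \<alpha>) * x) * (of_nat (p ^ \<beta>) * y) = of_nat (p ^ (r + \<alpha> + \<beta>)) * (x * y)"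
    for x y by (simp add: eps power_add mult_ac)
  have "(\<forall>x y. of_nat (p ^ (r + \<alpha> + \<beta>)) * (x * y) = (0 :: 'n mod_ring)) \<longleftrightarrow>
      (of_nat (p ^ (r + \<alpha> + \<beta>)) :: 'n mod_ring) = 0"
    by (metis mult_1_right mult_zero_left)
  then show ?thesis unfolding scalar_commutator_iff p_power_ideal_def ball_simps eq
    by (simp only: of_nat_p_power_eq_0_iff UNIV_I simp_thms ball_UNIV)
qed

end

end

theorem theorem4p6:
  fixes p r q :: nat
    and chi :: "(nat \<Rightarrow> int) set \<Rightarrow> complex"
    and eps :: "'n::nontriv mod_ring"
  assumes "prime p" and "odd p" and "1 \<le> r" and "1 \<le> q"
    and "CARD('n) = p ^ q"
    and "faithful_character p r q chi"
    and "eps = of_nat (p ^ r)"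
  shows
    "(\<forall>c s :: 'n mod_ring.
        has_column_action (C_op p r q chi c) (moebius_map (L_mat p r c)) \<and>
        has_column_action (S_op s) (moebius_map (U_mat s)) \<and>
        matrix_commutator (L_mat p r c) (U_mat s) =
          vector [vector [1 - eps * c * s, eps * c * s\<^sup>2],
                  vector [- (eps\<^sup>2 * c\<^sup>2 * s), 1 + eps * c * s + eps\<^sup>2 * c\<^sup>2 * s\<^sup>2]] \<and>
        map_commutator (moebius_map (L_mat p r c)) (moebius_map (U_mat s)) =
          moebius_map (matrix_commutator (L_mat p r c) (U_mat s)) \<and>
        has_column_action
          (inv_into UNIV (S_op s) \<circ> inv_into UNIV (C_op p r q chi c) \<circ> S_op s \<circ> C_op p r q chi c)
          (moebius_map (matrix_commutator (L_mat p r c) (U_mat s))) \<and>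
        has_column_action (operator_commutator p r q chi c s)
          (moebius_map (matrix_inv (U_mat s) ** matrix_inv (L_mat p r c) ** U_mat s ** L_mat p r c)) \<and>
        (is_scalar_operator (operator_commutator p r q chi c s) \<longleftrightarrow>
          is_scalar_matrix (matrix_commutator (L_mat p r c) (U_mat s))) \<and>
        (is_scalar_operator (operator_commutator p r q chi c s) \<longleftrightarrow> eps * c * s = 0) \<and>
        (eps * c * s = 0 \<longleftrightarrow>
          ereal_of_enat (vp p (c * s)) \<ge> ereal (real q - real r))) \<and>
     ((\<forall>c s :: 'n mod_ring. is_scalar_operator (operator_commutator p r q chi c s)) \<longleftrightarrow> q \<le> r) \<and>
     (q > r \<longrightarrow>
       (\<forall>\<alpha> \<beta>. \<alpha> \<le> q \<longrightarrow> \<beta> \<le> q \<longrightarrow>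
         ((\<forall>c \<in> (p_power_ideal p \<alpha> :: 'n mod_ring set). \<forall>s \<in> (p_power_ideal p \<beta> :: 'n mod_ring set).
             is_scalar_operator (operator_commutator p r q chi c s)) \<longleftrightarrow> r + \<alpha> + \<beta> \<ge> q)))"
proof -
  note setting = assms(1-5,7)
  note chi = assms(6)
  show ?thesis
    \<comment> \<open>The quantified criteria are replaced first, because the pointwise criterion
      used next would rewrite the commutators inside them.\<close>
    unfolding scalar_commutator_all_iff[OF setting chi] scalar_commutator_rectangle_iff[OF setting chi]
    unfolding scalar_matrix_commutator_iff[OF setting] scalar_commutator_iff[OF setting chi]
    by (intro conjI allI impI refl C_op_column_action[OF setting chi] S_op_column_action
        matrix_commutator_L_U[OF assms(7)] map_commutator_L_U[OF setting]
        reversed_commutator_column_action[OF setting chi]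
        operator_commutator_column_action[OF setting chi]
        eps_mult_eq_0_iff_vp[OF setting, of "c * s" for c s, folded mult.assoc])
qed

end
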